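(* There exists a constant $c>0$ with the following property. Let $d$ be a positive integer, let $\{\lambda_{k,d}\}_{0\le k\le d}$ be a sequence of positive numbers, and assume that for some integer $k$ with $1\le k<d-100$, $$\log\frac{\lambda_{j,d}^2}{\lambda_{j-1,d}\lambda_{j+1,d}}<2c,\qquad j=k,\dots,k+100.$$ Then there exists a polynomial $P$ of degree $d$ with positive coefficients such that $tr_P^\lambda$ has three tropical roots and $P$ has four negative roots. In particular, $\{\lambda_{k,d}\}_{0\le k\le d}$ is neither a degree $d$ real-to-tropical root preserver nor a degree $d$ positive real-to-tropical root preserver.
   Context: Tropical roots. For a real polynomial $P(x)=\sum_{k=0}^d a_kx^k$ of degree $d$, its $\lambda$-tropicalization is $tr_P^\lambda(\xi)=\max_{0\le k\le d}(k\xi+\ln|a_k|+\ln\lambda_{k,d})$, $\xi\in\mathbb{R}$ (terms with $a_k=0$ are ignored). A tropical root of $tr_P^\lambda$ is a value of $\xi$ at which the slope of $tr_P^\lambda$ changes; its multiplicity is one less than the number of terms attaining the maximum there. The tropical indices $k_0<\dots<k_m$ of $tr_P^\lambda$ are the integers $k\in\{0,\dots,d\}$ for which there is $x>0$ with $\lambda_{k,d}|a_k|x^k\ge\max_{i\ne k}\lambda_{i,d}|a_i|x^i$; the number of tropical roots counted with multiplicity is one less than the number of tropical indices. Essential tropical roots. The number of positive (resp. negative) essential tropical roots of $tr_P^\lambda$ is the number of sign alternations in $\{\mathrm{sgn}(a_{k_i})\}_{0\le i\le m}$ (resp. $\{\mathrm{sgn}((-1)^{k_i}a_{k_i})\}_{0\le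 i\le m}$). The number of essential tropical roots is the sum of these two numbers. A sequence $\{\lambda_{k,d}\}_{0\le k\le d}$ of positive numbers is a degree $d$ real-to-tropical root preserver (resp. degree $d$ positive real-to-tropical root preserver) if for every real polynomial $P$ of degree $d$ (resp. every polynomial $P$ of degree $d$ with positive coefficients) the number of essential tropical roots of $tr_P^\lambda$ is at least the number of non-zero real roots of $P$. *)

theory Defs
  imports Complex_Main "HOL-Computational_Algebra.Polynomial"
begin

(* A sequence (lambda_{k,d})_{0 <= k <= d} for a fixed degree d is a function lam :: nat => real
   of which only the values at k <= d matter. The degree d is read off from the polynomial. *)

definition trop_term :: "(nat \<Rightarrow> real) \<Rightarrow> real poly \<Rightarrow> nat \<Rightarrow> real \<Rightarrow> real" where
  "trop_term lam P k \<xi> = real k * \<xi> + ln \<bar>coeff P k\<bar> + ln (lam k)"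

definition tropicalization :: "(nat \<Rightarrow> real) \<Rightarrow> real poly \<Rightarrow> real \<Rightarrow> real" where
  "tropicalization lam P \<xi> =
     Max ((\<lambda>k. trop_term lam P k \<xi>) ` {k. k \<le> degree P \<and> coeff P k \<noteq> 0})"

(* The tropicalization is continuous and piecewise linear, so its slope changes at a point
   exactly when it fails to be differentiable there. *)
definition tropical_roots :: "(nat \<Rightarrow> real) \<Rightarrow> real poly \<Rightarrow> real set" where
  "tropical_roots lam P = {\<xi>. \<not> tropicalization lam P differentiable (at \<xi>)}"

definition tropical_mult :: "(nat \<Rightarrow> real) \<Rightarrow> real poly \<Rightarrow> real \<Rightarrow> nat" where
  "tropical_mult lam P \<xi> =
     card {k. k \<le> degree P \<and> coeff P k \<noteq> 0 \<and>
              trop_term lam P k \<xi> = tropicalization lam P \<xi>} - 1"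

definition tropical_indices :: "(nat \<Rightarrow> real) \<Rightarrow> real poly \<Rightarrow> nat set" where
  "tropical_indices lam P =
     {k. k \<le> degree P \<and>
         (\<exists>x>0. \<forall>i\<le>degree P. i \<noteq> k \<longrightarrow>
            lam i * \<bar>coeff P i\<bar> * x ^ i \<le> lam k * \<bar>coeff P k\<bar> * x ^ k)}"

(* Meant for lists without zeros; the coefficients at tropical indices never vanish
   when lam is positive and the polynomial is non-zero. *)
definition sign_alternations :: "real list \<Rightarrow> nat" where
  "sign_alternations xs = card {i. Suc i < length xs \<and> sgn (xs ! i) \<noteq> sgn (xs ! Suc i)}"

definition pos_essential_roots :: "(nat \<Rightarrow> real) \<Rightarrow> real poly \<Rightarrow> nat" where
  "pos_essential_roots lam P =
     sign_alternations (map (\<lambda>k. coeff P k) (sorted_list_of_set (tropical_indices lam P)))"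

definition neg_essential_roots :: "(nat \<Rightarrow> real) \<Rightarrow> real poly \<Rightarrow> nat" where
  "neg_essential_roots lam P =
     sign_alternations
       (map (\<lambda>k. (- 1) ^ k * coeff P k) (sorted_list_of_set (tropical_indices lam P)))"

definition essential_roots :: "(nat \<Rightarrow> real) \<Rightarrow> real poly \<Rightarrow> nat" where
  "essential_roots lam P = pos_essential_roots lam P + neg_essential_roots lam P"

definition pos_coeffs :: "real poly \<Rightarrow> bool" where
  "pos_coeffs P \<longleftrightarrow> (\<forall>k\<le>degree P. coeff P k > 0)"

(* Real roots are counted without multiplicity. Counting them with multiplicity gives the same
   preservers: multiple real roots can be split into simple ones by an arbitrarily small change
   of the polynomial, and a small change never increases the number of essential roots.
   In any case, failing to be a preserver for the count used here implies failing to be one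
   for the count with multiplicity. *)
definition root_preserver :: "nat \<Rightarrow> (nat \<Rightarrow> real) \<Rightarrow> bool" where
  "root_preserver d lam \<longleftrightarrow>
     (\<forall>k\<le>d. lam k > 0) \<and>
     (\<forall>P. P \<noteq> 0 \<and> degree P = d \<longrightarrow>
        card {x. x \<noteq> 0 \<and> poly P x = 0} \<le> essential_roots lam P)"

definition positive_root_preserver :: "nat \<Rightarrow> (nat \<Rightarrow> real) \<Rightarrow> bool" where
  "positive_root_preserver d lam \<longleftrightarrow>
     (\<forall>k\<le>d. lam k > 0) \<and>
     (\<forall>P. degree P = d \<and> pos_coeffs P \<longrightarrow>
        card {x. x \<noteq> 0 \<and> poly P x = 0} \<le> essential_roots lam P)"

end

theory Submission
  imports Defs
begin

text \<open>
  The polynomial with too many roots is a perturbation, as \<open>t\<close> tends to \<open>0\<close> from above, of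
  \<open>x ^ p * Q x\<close> with \<open>Q x = 1 + 9/10 * (x + x ^ 3 + x ^ 18 + x ^ 20) + x ^ 21\<close>, where \<open>p\<close> is odd
  and the exponents from \<open>p\<close> to \<open>p + 21\<close> lie in the range where \<open>lam\<close> is nearly log-convex. All
  other coefficients up to degree \<open>d\<close> are set to \<open>t\<close>.

  Real roots. The signs of \<open>x ^ p * Q x\<close> at \<open>-10\<close>, \<open>-5/4\<close>, \<open>-4/5\<close>, \<open>-2/5\<close> are \<open>+\<close>, \<open>-\<close>, \<open>+\<close>,
  \<open>-\<close>: near \<open>-4/5\<close> the low odd powers \<open>x\<close> and \<open>x ^ 3\<close> together outweigh the constant term \<open>1\<close>, while
  \<open>x ^ 18\<close> and \<open>x ^ 20\<close> are still negligible, and the point \<open>-5/4\<close> is its mirror image because \<open>Q\<close> is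
  palindromic of odd degree. The signs persist for small \<open>t\<close>, and the value at \<open>0\<close> is \<open>t > 0\<close>. The
  intermediate value theorem gives four negative roots.

  Tropical roots. Let \<open>w k\<close> be the logarithm of \<open>lam k\<close> times the \<open>k\<close>-th coefficient. For small \<open>t\<close>
  the upper concave hull of \<open>w\<close> has exactly the vertices \<open>0\<close>, \<open>p\<close>, \<open>p + 21\<close> and \<open>d\<close>. At the indices
  whose coefficient is \<open>t\<close>, apart from \<open>0\<close> and \<open>d\<close>, the chord between neighbouring vertices carries a
  smaller multiple of \<open>ln t\<close> than \<open>w\<close>, so it lies above \<open>w\<close> once \<open>t\<close> is small. At the four indices
  with coefficient \<open>9/10\<close>, near log-convexity keeps \<open>ln (lam k)\<close> from exceeding its chord by more
  than \<open>-ln (9/10)\<close> (\<open>near_convex_chord\<close>). Four vertices joined by edges of strictly decreasing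
  slopes, with all other points strictly below, mean three tropical roots of multiplicity one
  (\<open>four_vertex_tropicalization\<close>).

  A polynomial with positive coefficients has fewer essential roots than tropical indices, so here
  there are at most three essential roots, but at least four nonzero real roots.
\<close>

section \<open>Discrete convexity\<close>

lemma discrete_convex_chord:
  fixes g :: "nat \<Rightarrow> real"
  assumes conv: "\<And>j. 0 < j \<Longrightarrow> j < n \<Longrightarrow> 2 * g j \<le> g (j - 1) + g (j + 1)"
    and i: "i < n"
  shows "real n * g i \<le> real (n - i) * g 0 + real i * g n"
proof -
  \<comment> \<open>The increments grow, so the mean slopes to the left and right of \<open>i\<close> are separated by \<open>D i\<close>.\<close>
  define D where "D j = g (Suc j) - g j" for j
  have step: "D j \<le> D (Suc j)" if "Suc j < n" for j
    using conv[of "Suc j"] that by (simp add: D_def)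
  have mono: "D j \<le> D k" if "j \<le> k" "k < n" for j k
    using that
  proof (induction k rule: dec_induct)
    case (step m)
    then show ?case using \<open>\<And>j. Suc j < n \<Longrightarrow> D j \<le> D (Suc j)\<close>[of m] by simp
  qed simp
  have "g i - g 0 = (\<Sum>j<i. D j)"
    by (simp add: D_def sum_lessThan_telescope)
  also have "\<dots> \<le> real i * D i"
    using sum_bounded_above[of "{..<i}" D "D i"] mono[of _ i] i by simp
  finally have left: "g i - g 0 \<le> real i * D i" .
  have "g n - g i = (\<Sum>j=i..<n. D j)"
    using i by (simp add: D_def sum_Suc_diff')
  also have "\<dots> \<ge> real (n - i) * D i"
    using sum_bounded_below[of "{i..<n}" "D i" D] mono[of i] by simp
  finally have right: "real (n - i) * D i \<le> g n - g i" .
  have "real (n - i) * (g i - g 0) \<le> real (n - i) * (real i * D i)"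
    by (intro mult_left_mono left) simp
  also have "\<dots> = real i * (real (n - i) * D i)" by simp
  also have "\<dots> \<le> real i * (g n - g i)"
    by (intro mult_left_mono right) simp
  finally show ?thesis using i by (simp add: of_nat_diff algebra_simps)
qed

text \<open>
  If the second differences of \<open>f\<close> are at least \<open>- 2 * c\<close>, adding \<open>c * j\<^sup>2\<close> makes it convex. Hence
  \<open>f i\<close> exceeds the chord by at most \<open>c * i * (n - i)\<close>; the inequality is multiplied by \<open>n\<close>.
\<close>

lemma near_convex_chord:
  fixes f :: "nat \<Rightarrow> real"
  assumes conv: "\<And>j. 0 < j \<Longrightarrow> j < n \<Longrightarrow> 2 * f j - f (j - 1) - f (j + 1) \<le> 2 * c"
    and i: "i < n"
  shows "real n * f i \<le> real (n - i) * f 0 + real i * f n + c * real (n * (i * (n - i)))"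
proof -
  have "real n * (f i + c * (real i)\<^sup>2)
      \<le> real (n - i) * (f 0 + c * (real 0)\<^sup>2) + real i * (f n + c * (real n)\<^sup>2)"
  proof (rule discrete_convex_chord[OF _ i])
    fix j :: nat assume j: "0 < j" "j < n"
    show "2 * (f j + c * (real j)\<^sup>2)
        \<le> f (j - 1) + c * (real (j - 1))\<^sup>2 + (f (j + 1) + c * (real (j + 1))\<^sup>2)"
      using conv[OF j] j by (simp add: of_nat_diff power2_eq_square algebra_simps)
  qed
  then show ?thesis using i by (simp add: of_nat_diff power2_eq_square algebra_simps)
qed

section \<open>Tropicalizations with four vertices\<close>

lemma kink_not_differentiable:
  fixes F :: "real \<Rightarrow> real"
  assumes "l < x" "x < r" "a \<noteq> a'"
    and left: "\<And>y. l < y \<Longrightarrow> y \<le> x \<Longrightarrow> F y = a * y + b"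
    and right: "\<And>y. x \<le> y \<Longrightarrow> y < r \<Longrightarrow> F y = a' * y + b'"
  shows "\<not> F differentiable (at x)"
proof
  assume "F differentiable (at x)"
  then obtain D where D: "(F has_field_derivative D) (at x)"
    by (auto simp: real_differentiable_def)
  have "((\<lambda>y. a * y + b) has_field_derivative D) (at x within {..x})"
    by (rule has_field_derivative_transform_within
        [OF has_field_derivative_at_within[OF D], of "x - l"])
      (use assms(1) left in \<open>auto simp: dist_real_def\<close>)
  then have "((\<lambda>y. a * y + b) has_field_derivative D) (at_left x)"
    by (rule DERIV_subset) auto
  moreover have "((\<lambda>y. a * y + b) has_field_derivative a) (at_left x)"
    by (auto intro!: derivative_eq_intros)
  ultimately have "D = a"
    by (rule has_field_derivative_unique) simp
  have "((\<lambda>y. a' * y + b') has_field_derivative D) (at x within {x..})"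
    by (rule has_field_derivative_transform_within
        [OF has_field_derivative_at_within[OF D], of "r - x"])
      (use assms(2) right in \<open>auto simp: dist_real_def\<close>)
  then have "((\<lambda>y. a' * y + b') has_field_derivative D) (at_right x)"
    by (rule DERIV_subset) auto
  moreover have "((\<lambda>y. a' * y + b') has_field_derivative a') (at_right x)"
    by (auto intro!: derivative_eq_intros)
  ultimately have "D = a'"
    by (rule has_field_derivative_unique) simp
  with \<open>D = a\<close> \<open>a \<noteq> a'\<close> show False by simp
qed

lemma trop_term_less_iff:
  assumes "a < b"
  shows "trop_term lam P a \<xi> < trop_term lam P b \<xi> \<longleftrightarrow>
    (trop_term lam P a 0 - trop_term lam P b 0) / real (b - a) < \<xi>"
  using assms by (simp add: trop_term_def of_nat_diff field_simps)

lemma trop_term_eq_iff: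
  assumes "a < b"
  shows "trop_term lam P a \<xi> = trop_term lam P b \<xi> \<longleftrightarrow>
    \<xi> = (trop_term lam P a 0 - trop_term lam P b 0) / real (b - a)"
  using assms by (auto simp add: trop_term_def of_nat_diff field_simps)

text \<open>
  The points \<open>(i, w i)\<close> strictly between the abscissas \<open>a\<close> and \<open>b\<close> lie strictly below the segment
  joining \<open>(a, w a)\<close> and \<open>(b, w b)\<close>. The inequality is multiplied by \<open>b - a\<close>.
\<close>

definition below_chord :: "(nat \<Rightarrow> real) \<Rightarrow> nat \<Rightarrow> nat \<Rightarrow> bool" where
  "below_chord w a b \<longleftrightarrow>
    (\<forall>i. a < i \<and> i < b \<longrightarrow> real (b - a) * w i < real (b - i) * w a + real (i - a) * w b)"

text \<open>
  A term below the chord never attains the maximum: were it to dominate both end terms at \<open>\<xi>\<close>,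
  it would dominate their convex combination.
\<close>

lemma below_chord_trop_term:
  assumes "below_chord (\<lambda>k. trop_term lam P k 0) a b" "a < i" "i < b"
  shows "trop_term lam P i \<xi> < trop_term lam P a \<xi> \<or> trop_term lam P i \<xi> < trop_term lam P b \<xi>"
proof (rule ccontr)
  assume "\<not> ?thesis"
  then have "real (b - i) * trop_term lam P a \<xi> + real (i - a) * trop_term lam P b \<xi>
      \<le> real (b - i) * trop_term lam P i \<xi> + real (i - a) * trop_term lam P i \<xi>"
    by (intro add_mono mult_left_mono) auto
  moreover have "real (b - a) * trop_term lam P i 0
      < real (b - i) * trop_term lam P a 0 + real (i - a) * trop_term lam P b 0"
    using assms by (simp add: below_chord_def)
  ultimately show False
    using assms(2,3) by (simp add: trop_term_def of_nat_diff algebra_simps)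
qed

text \<open>
  The value of \<open>trop_term lam P k\<close> at \<open>0\<close> is the height \<open>ln \<bar>coeff P k\<bar> + ln (lam k)\<close>. The lines of
  slopes \<open>a < b\<close> cross at the negated slope of the segment joining their heights, so the assumption
  on slopes says that the hull through \<open>0\<close>, \<open>p\<close>, \<open>q\<close>, \<open>d\<close> is strictly concave, and the three
  quotients in it are the tropical roots.
\<close>

lemma four_vertex_tropicalization:
  fixes lam :: "nat \<Rightarrow> real" and P :: "real poly" and p q :: nat
  defines "d \<equiv> degree P" and "w \<equiv> \<lambda>k. trop_term lam P k 0"
  assumes pos: "pos_coeffs P"
    and order: "0 < p" "p < q" "q < d"
    and chords: "below_chord w 0 p" "below_chord w p q" "below_chord w q d"
    and slopes: "(w 0 - w p) / real (p - 0) < (w p - w q) / real (q - p)"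
      "(w p - w q) / real (q - p) < (w q - w d) / real (d - q)"
  shows "card (tropical_roots lam P) = 3"
    and "(\<Sum>\<xi>\<in>tropical_roots lam P. tropical_mult lam P \<xi>) = 3"
    and "\<And>k \<xi>. k \<le> d \<Longrightarrow> (\<And>i. i \<le> d \<Longrightarrow> trop_term lam P i \<xi> \<le> trop_term lam P k \<xi>)
      \<Longrightarrow> k \<in> {0, p, q, d}"
proof -
  let ?T = "trop_term lam P" and ?F = "tropicalization lam P"
  define x0 x1 x2 where "x0 = (w 0 - w p) / real (p - 0)" and "x1 = (w p - w q) / real (q - p)"
    and "x2 = (w q - w d) / real (d - q)"
  have x: "x0 < x1" "x1 < x2" using slopes by (simp_all add: x0_def x1_def x2_def)
  have lt: "?T 0 \<xi> < ?T p \<xi> \<longleftrightarrow> x0 < \<xi>" "?T p \<xi> < ?T q \<xi> \<longleftrightarrow> x1 < \<xi>"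
    "?T q \<xi> < ?T d \<xi> \<longleftrightarrow> x2 < \<xi>" for \<xi>
    using trop_term_less_iff[of 0 p lam P \<xi>] trop_term_less_iff[of p q lam P \<xi>]
      trop_term_less_iff[of q d lam P \<xi>] order by (simp_all add: x0_def x1_def x2_def w_def)
  have eq: "?T 0 \<xi> = ?T p \<xi> \<longleftrightarrow> \<xi> = x0" "?T p \<xi> = ?T q \<xi> \<longleftrightarrow> \<xi> = x1"
    "?T q \<xi> = ?T d \<xi> \<longleftrightarrow> \<xi> = x2" for \<xi>
    using trop_term_eq_iff[of 0 p lam P \<xi>] trop_term_eq_iff[of p q lam P \<xi>]
      trop_term_eq_iff[of q d lam P \<xi>] order by (simp_all add: x0_def x1_def x2_def w_def)
  have support: "{k. k \<le> degree P \<and> coeff P k \<noteq> 0} = {..d}"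
    using pos by (force simp: pos_coeffs_def d_def)
  have beaten: "\<exists>v\<in>{0, p, q, d}. ?T k \<xi> < ?T v \<xi>" if k: "k \<le> d" "k \<notin> {0, p, q, d}" for k \<xi>
  proof -
    consider "0 < k" "k < p" | "p < k" "k < q" | "q < k" "k < d"
      using k by fastforce
    then show ?thesis
      using below_chord_trop_term[of lam P _ _ k \<xi>] chords unfolding w_def by cases blast+
  qed
  have F_eq: "?F \<xi> = ?T v \<xi>" if "v \<in> {0, p, q, d}" "\<And>v'. v' \<in> {0, p, q, d} \<Longrightarrow> ?T v' \<xi> \<le> ?T v \<xi>"
    for v \<xi>
  proof -
    have le: "?T k \<xi> \<le> ?T v \<xi>" if "k \<le> d" for k
      using beaten[OF that, of \<xi>] \<open>\<And>v'. v' \<in> {0, p, q, d} \<Longrightarrow> ?T v' \<xi> \<le> ?T v \<xi>\<close>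
      by (cases "k \<in> {0, p, q, d}") (auto intro: order.trans less_imp_le)
    show ?thesis
      unfolding tropicalization_def support
      by (rule Max_eqI) (use le that(1) order in auto)
  qed
  have ge: "?T p \<xi> \<le> ?T 0 \<xi> \<longleftrightarrow> \<xi> \<le> x0" "?T q \<xi> \<le> ?T p \<xi> \<longleftrightarrow> \<xi> \<le> x1"
    "?T d \<xi> \<le> ?T q \<xi> \<longleftrightarrow> \<xi> \<le> x2" for \<xi>
    using lt[of \<xi>] by (simp_all flip: not_less)
  have le: "?T 0 \<xi> \<le> ?T p \<xi> \<longleftrightarrow> x0 \<le> \<xi>" "?T p \<xi> \<le> ?T q \<xi> \<longleftrightarrow> x1 \<le> \<xi>"
    "?T q \<xi> \<le> ?T d \<xi> \<longleftrightarrow> x2 \<le> \<xi>" for \<xi>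
    using lt[of \<xi>] eq[of \<xi>] by (auto simp: le_less)
  have F0: "?F \<xi> = ?T 0 \<xi>" if "\<xi> \<le> x0" for \<xi>
  proof -
    have "?T p \<xi> \<le> ?T 0 \<xi>" "?T q \<xi> \<le> ?T p \<xi>" "?T d \<xi> \<le> ?T q \<xi>" using that x ge by auto
    then show ?thesis by (intro F_eq) auto
  qed
  have F1: "?F \<xi> = ?T p \<xi>" if "x0 \<le> \<xi>" "\<xi> \<le> x1" for \<xi>
  proof -
    have "?T 0 \<xi> \<le> ?T p \<xi>" "?T q \<xi> \<le> ?T p \<xi>" "?T d \<xi> \<le> ?T q \<xi>" using that x le ge by auto
    then show ?thesis by (intro F_eq) auto
  qed
  have F2: "?F \<xi> = ?T q \<xi>" if "x1 \<le> \<xi>" "\<xi> \<le> x2" for \<xi>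
  proof -
    have "?T 0 \<xi> \<le> ?T p \<xi>" "?T p \<xi> \<le> ?T q \<xi>" "?T d \<xi> \<le> ?T q \<xi>" using that x le ge by auto
    then show ?thesis by (intro F_eq) auto
  qed
  have F3: "?F \<xi> = ?T d \<xi>" if "x2 \<le> \<xi>" for \<xi>
  proof -
    have "?T 0 \<xi> \<le> ?T p \<xi>" "?T p \<xi> \<le> ?T q \<xi>" "?T q \<xi> \<le> ?T d \<xi>" using that x le by auto
    then show ?thesis by (intro F_eq) auto
  qed
  note F = F0 F1 F2 F3
  have T: "?T k \<xi> = real k * \<xi> + w k" for k \<xi>
    by (simp add: trop_term_def w_def)
  have diff: "?F differentiable (at \<xi>)"
    if "open U" "\<xi> \<in> U" "\<And>y. y \<in> U \<Longrightarrow> ?F y = ?T k y" for U k \<xi>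
  proof -
    have "((\<lambda>y. real k * y + w k) has_field_derivative real k) (at \<xi>)"
      by (auto intro!: derivative_eq_intros)
    then have "(?F has_field_derivative real k) (at \<xi>)"
      by (rule has_field_derivative_transform_within_open[OF _ that(1,2)]) (simp add: that T)
    then show ?thesis by (auto simp: real_differentiable_def)
  qed
  have roots: "tropical_roots lam P = {x0, x1, x2}"
  proof (intro set_eqI iffI)
    fix \<xi> assume "\<xi> \<in> {x0, x1, x2}"
    moreover have "\<not> ?F differentiable (at x0)"
      by (rule kink_not_differentiable[of "x0 - 1" x0 x1 "real 0" "real p" _ "w 0" "w p"])
        (use x order F in \<open>auto simp: T\<close>)
    moreover have "\<not> ?F differentiable (at x1)"
      by (rule kink_not_differentiable[of x0 x1 x2 "real p" "real q" _ "w p" "w q"])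
        (use x order F in \<open>auto simp: T\<close>)
    moreover have "\<not> ?F differentiable (at x2)"
      by (rule kink_not_differentiable[of x1 x2 "x2 + 1" "real q" "real d" _ "w q" "w d"])
        (use x order F in \<open>auto simp: T\<close>)
    ultimately show "\<xi> \<in> tropical_roots lam P" by (auto simp: tropical_roots_def)
  next
    fix \<xi> assume "\<xi> \<in> tropical_roots lam P"
    then have nd: "\<not> ?F differentiable (at \<xi>)" by (simp add: tropical_roots_def)
    show "\<xi> \<in> {x0, x1, x2}"
    proof (rule ccontr)
      assume "\<xi> \<notin> {x0, x1, x2}"
      then consider "\<xi> < x0" | "x0 < \<xi>" "\<xi> < x1" | "x1 < \<xi>" "\<xi> < x2" | "x2 < \<xi>"
        by fastforce
      then have "?F differentiable (at \<xi>)"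
      proof cases
        case 1 then show ?thesis using F by (intro diff[of "{..<x0}" _ 0]) auto
      next
        case 2 then show ?thesis using F by (intro diff[of "{x0<..<x1}" _ p]) auto
      next
        case 3 then show ?thesis using F by (intro diff[of "{x1<..<x2}" _ q]) auto
      next
        case 4 then show ?thesis using F by (intro diff[of "{x2<..}" _ d]) auto
      qed
      with nd show False ..
    qed
  qed
  have F_max: "?T k \<xi> \<le> ?F \<xi>" if "k \<le> d" for k \<xi>
    unfolding tropicalization_def support using that by (intro Max_ge) auto
  have maximizers: "{k. k \<le> degree P \<and> coeff P k \<noteq> 0 \<and> ?T k \<xi> = ?F \<xi>}
      = {v \<in> {0, p, q, d}. ?T v \<xi> = ?F \<xi>}" for \<xi>
  proof -
    have "?T k \<xi> \<noteq> ?F \<xi>" if k: "k \<le> d" "k \<notin> {0, p, q, d}" for k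
    proof -
      obtain v where "v \<in> {0, p, q, d}" "?T k \<xi> < ?T v \<xi>" using beaten[OF k] by blast
      moreover from this have "?T v \<xi> \<le> ?F \<xi>" using order by (intro F_max) auto
      ultimately show ?thesis by simp
    qed
    moreover have "coeff P k \<noteq> 0 \<longleftrightarrow> k \<le> d" if "k \<le> d" for k
      using support that by blast
    ultimately show ?thesis using order unfolding d_def by auto
  qed
  have mult: "tropical_mult lam P \<xi> = 1" if \<xi>: "\<xi> \<in> {x0, x1, x2}" for \<xi>
  proof -
    consider "\<xi> = x0" | "\<xi> = x1" | "\<xi> = x2" using \<xi> by blast
    then have "card {v \<in> {0, p, q, d}. ?T v \<xi> = ?F \<xi>} = 2"
    proof cases
      case 1
      then have "{v \<in> {0, p, q, d}. ?T v \<xi> = ?F \<xi>} = {0, p}"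
        using F[of \<xi>] lt[of \<xi>] eq[of \<xi>] x by auto
      then show ?thesis using order by simp
    next
      case 2
      then have "{v \<in> {0, p, q, d}. ?T v \<xi> = ?F \<xi>} = {p, q}"
        using F[of \<xi>] lt[of \<xi>] eq[of \<xi>] x by auto
      then show ?thesis using order by simp
    next
      case 3
      then have "{v \<in> {0, p, q, d}. ?T v \<xi> = ?F \<xi>} = {q, d}"
        using F[of \<xi>] lt[of \<xi>] eq[of \<xi>] x by auto
      then show ?thesis using order by simp
    qed
    then show ?thesis unfolding tropical_mult_def maximizers by simp
  qed
  show "card (tropical_roots lam P) = 3" using x by (simp add: roots)
  show "(\<Sum>\<xi>\<in>tropical_roots lam P. tropical_mult lam P \<xi>) = 3"
    using x mult by (simp add: roots)
  show "k \<in> {0, p, q, d}"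
    if k: "k \<le> d" "\<And>i. i \<le> d \<Longrightarrow> ?T i \<xi> \<le> ?T k \<xi>" for k \<xi>
  proof (rule ccontr)
    assume "k \<notin> {0, p, q, d}"
    then obtain v where "v \<in> {0, p, q, d}" "?T k \<xi> < ?T v \<xi>"
      using beaten[OF k(1)] by blast
    moreover from this have "?T v \<xi> \<le> ?T k \<xi>" using order by (intro k(2)) auto
    ultimately show False by simp
  qed
qed


section \<open>Essential roots of polynomials with positive coefficients\<close>

lemma sign_alternations_le: "sign_alternations xs \<le> length xs - 1"
proof -
  have "sign_alternations xs \<le> card {..<length xs - 1}"
    unfolding sign_alternations_def by (rule card_mono) auto
  then show ?thesis by simp
qed

lemma finite_tropical_indices: "finite (tropical_indices lam P)"
  by (rule finite_subset[of _ "{..degree P}"]) (auto simp: tropical_indices_def)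

lemma pos_essential_roots_pos_coeffs:
  assumes "pos_coeffs P"
  shows "pos_essential_roots lam P = 0"
proof -
  define ks where "ks = sorted_list_of_set (tropical_indices lam P)"
  have "set ks \<subseteq> {..degree P}"
    using finite_tropical_indices[of lam P] by (auto simp: ks_def tropical_indices_def)
  then have "sgn (coeff P (ks ! i)) = 1" if "i < length ks" for i
    using assms nth_mem[OF that] by (auto simp: pos_coeffs_def intro!: sgn_pos)
  then have "{i. Suc i < length ks \<and>
      sgn (map (coeff P) ks ! i) \<noteq> sgn (map (coeff P) ks ! Suc i)} = {}"
    by auto
  then show ?thesis
    unfolding pos_essential_roots_def sign_alternations_def length_map ks_def[symmetric]
    by (simp only: card.empty)
qed

lemma essential_roots_pos_coeffs_le:
  assumes "pos_coeffs P"
  shows "essential_roots lam P \<le> card (tropical_indices lam P) - 1"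
  using sign_alternations_le[of "map (\<lambda>k. (- 1) ^ k * coeff P k)
      (sorted_list_of_set (tropical_indices lam P))"]
  by (simp add: essential_roots_def pos_essential_roots_pos_coeffs[OF assms]
      neg_essential_roots_def)

text \<open>Substituting \<open>\<xi> = ln x\<close> turns the monomials of the definition into tropical terms.\<close>

lemma tropical_indices_maximize:
  assumes lam: "\<And>k. k \<le> degree P \<Longrightarrow> lam k > 0" and pos: "pos_coeffs P"
    and k: "k \<in> tropical_indices lam P"
  obtains \<xi> where "\<And>i. i \<le> degree P \<Longrightarrow> trop_term lam P i \<xi> \<le> trop_term lam P k \<xi>"
proof -
  obtain x where x: "x > 0" and le: "\<And>i. i \<le> degree P \<Longrightarrow>
      lam i * \<bar>coeff P i\<bar> * x ^ i \<le> lam k * \<bar>coeff P k\<bar> * x ^ k"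
    using k by (fastforce simp: tropical_indices_def)
  have "exp (trop_term lam P i (ln x)) = lam i * \<bar>coeff P i\<bar> * x ^ i" if "i \<le> degree P" for i
    using lam[OF that] pos that x
    by (auto simp: trop_term_def exp_add exp_of_nat_mult pos_coeffs_def)
  then have "trop_term lam P i (ln x) \<le> trop_term lam P k (ln x)" if "i \<le> degree P" for i
    using le[OF that] k that by (metis (lifting) CollectD exp_le_cancel_iff tropical_indices_def)
  then show ?thesis by (rule that)
qed

section \<open>A polynomial with four sign changes over three edges\<close>

text \<open>
  The coefficients of the polynomial described at the beginning. Those of the vertices \<open>0\<close> and \<open>d\<close>
  are also \<open>t\<close> when \<open>0 < p\<close> and \<open>p + 21 < d\<close>, so that a single small parameter suffices.
\<close>

definition edge_coeff :: "nat \<Rightarrow> real \<Rightarrow> nat \<Rightarrow> real" where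
  "edge_coeff p t i =
    (if i = p \<or> i = p + 21 then 1
     else if i \<in> {p + 1, p + 3, p + 18, p + 20} then 9 / 10 else t)"

definition edge_poly :: "nat \<Rightarrow> nat \<Rightarrow> real \<Rightarrow> real poly" where
  "edge_poly d p t = (\<Sum>i\<le>d. monom (edge_coeff p t i) i)"

text \<open>The polynomial function \<open>Q\<close> that remains for \<open>t = 0\<close> after division by \<open>x ^ p\<close>.\<close>

definition edge_limit :: "real \<Rightarrow> real" where
  "edge_limit x = 1 + 9 / 10 * (x + x ^ 3 + x ^ 18 + x ^ 20) + x ^ 21"

lemma coeff_edge_poly: "coeff (edge_poly d p t) i = (if i \<le> d then edge_coeff p t i else 0)"
  by (simp add: edge_poly_def coeff_sum sum.delta)

lemma edge_coeff_pos: "t > 0 \<Longrightarrow> edge_coeff p t i > 0"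
  by (simp add: edge_coeff_def)

lemma degree_edge_poly:
  assumes "t > 0"
  shows "degree (edge_poly d p t) = d"
proof (rule antisym)
  show "degree (edge_poly d p t) \<le> d" by (rule degree_le) (simp add: coeff_edge_poly)
  show "d \<le> degree (edge_poly d p t)"
    using edge_coeff_pos[OF assms, of p d] by (intro le_degree) (simp add: coeff_edge_poly)
qed

lemma pos_coeffs_edge_poly: "t > 0 \<Longrightarrow> pos_coeffs (edge_poly d p t)"
  by (simp add: pos_coeffs_def coeff_edge_poly degree_edge_poly edge_coeff_pos)

lemma tendsto_edge_poly:
  assumes "p + 21 \<le> d"
  shows "((\<lambda>t. poly (edge_poly d p t) x) \<longlongrightarrow> x ^ p * edge_limit x) (at_right 0)"
proof -
  let ?S = "{p, p + 1, p + 3, p + 18, p + 20, p + 21}"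
  have "((\<lambda>t. edge_coeff p t i) \<longlongrightarrow> edge_coeff p 0 i) (at_right 0)" for i
    unfolding edge_coeff_def by (cases "i = p \<or> i = p + 21"; cases "i \<in> {p + 1, p + 3, p + 18, p + 20}") auto
  then have "((\<lambda>t. \<Sum>i\<le>d. edge_coeff p t i * x ^ i) \<longlongrightarrow> (\<Sum>i\<le>d. edge_coeff p 0 i * x ^ i))
      (at_right 0)"
    by (intro tendsto_sum tendsto_mult tendsto_const)
  also have "(\<Sum>i\<le>d. edge_coeff p 0 i * x ^ i) = (\<Sum>i\<in>?S. edge_coeff p 0 i * x ^ i)"
    using assms by (intro sum.mono_neutral_right) (auto simp: edge_coeff_def)
  also have "\<dots> = x ^ p * edge_limit x"
    by (simp add: edge_coeff_def edge_limit_def power_add algebra_simps)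
  finally show ?thesis by (simp add: edge_poly_def poly_sum poly_monom)
qed

lemma eventually_edge_poly_negative_roots:
  assumes "p + 21 \<le> d" "odd p"
  shows "eventually (\<lambda>t. card {x. x < 0 \<and> poly (edge_poly d p t) x = 0} \<ge> 4) (at_right 0)"
proof -
  have neg: "eventually (\<lambda>t. poly (edge_poly d p t) x < 0) (at_right 0)"
    if "x < 0" "edge_limit x > 0" for x
    using that assms(2) by (intro order_tendstoD(2)[OF tendsto_edge_poly[OF assms(1)]])
      (simp add: mult_neg_pos power_less_zero_eq)
  have pos: "eventually (\<lambda>t. poly (edge_poly d p t) x > 0) (at_right 0)"
    if "x < 0" "edge_limit x < 0" for x
    using that assms(2) by (intro order_tendstoD(1)[OF tendsto_edge_poly[OF assms(1)]])
      (simp add: mult_neg_neg power_less_zero_eq)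
  have "eventually (\<lambda>t. t > (0::real)) (at_right 0)" by (simp add: eventually_at_right_less)
  moreover have "eventually (\<lambda>t. poly (edge_poly d p t) (- 2 / 5) < 0) (at_right 0)"
    by (rule neg) (simp_all add: edge_limit_def power_divide)
  moreover have "eventually (\<lambda>t. poly (edge_poly d p t) (- 4 / 5) > 0) (at_right 0)"
    by (rule pos) (simp_all add: edge_limit_def power_divide)
  moreover have "eventually (\<lambda>t. poly (edge_poly d p t) (- 5 / 4) < 0) (at_right 0)"
    by (rule neg) (simp_all add: edge_limit_def power_divide)
  moreover have "eventually (\<lambda>t. poly (edge_poly d p t) (- 10) > 0) (at_right 0)"
    by (rule pos) (simp_all add: edge_limit_def power_divide)
  ultimately show ?thesis
  proof eventually_elim
    case (elim t)
    let ?P = "edge_poly d p t"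
    have "0 < p" using \<open>odd p\<close> by (rule odd_pos)
    then have P0: "poly ?P 0 > 0"
      using edge_coeff_pos[OF elim(1)] by (simp add: poly_0_coeff_0 coeff_edge_poly)
    obtain r1 where r1: "- 10 < r1" "r1 < - 5 / 4" "poly ?P r1 = 0"
      using poly_IVT_neg[of "- 10" "- 5 / 4" ?P] elim by auto
    obtain r2 where r2: "- 5 / 4 < r2" "r2 < - 4 / 5" "poly ?P r2 = 0"
      using poly_IVT_pos[of "- 5 / 4" "- 4 / 5" ?P] elim by auto
    obtain r3 where r3: "- 4 / 5 < r3" "r3 < - 2 / 5" "poly ?P r3 = 0"
      using poly_IVT_neg[of "- 4 / 5" "- 2 / 5" ?P] elim by auto
    obtain r4 where r4: "- 2 / 5 < r4" "r4 < 0" "poly ?P r4 = 0"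
      using poly_IVT_pos[of "- 2 / 5" 0 ?P] elim P0 by auto
    have "?P \<noteq> 0" using P0 by auto
    then have "finite {x. x < 0 \<and> poly ?P x = 0}"
      by (rule finite_subset[OF _ poly_roots_finite, rotated]) auto
    then have "card {r1, r2, r3, r4} \<le> card {x. x < 0 \<and> poly ?P x = 0}"
      by (rule card_mono) (use r1 r2 r3 r4 in auto)
    moreover have "card {r1, r2, r3, r4} = 4" using r1 r2 r3 r4 by simp
    ultimately show ?case by simp
  qed
qed

lemma eventually_ln_less:
  fixes a b :: real
  assumes "a > 0"
  shows "eventually (\<lambda>t. a * ln t < b) (at_right 0)"
proof -
  have "eventually (\<lambda>t::real. ln t < b / a) (at_right 0)"
    using ln_at_0 by (simp add: filterlim_at_bot_dense)
  then show ?thesis by eventually_elim (use assms in \<open>simp add: field_simps\<close>)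
qed

lemma eventually_below_chord:
  fixes w :: "real \<Rightarrow> nat \<Rightarrow> real"
  assumes "\<And>i. a < i \<Longrightarrow> i < b \<Longrightarrow> eventually (\<lambda>t.
      real (b - a) * w t i < real (b - i) * w t a + real (i - a) * w t b) F"
  shows "eventually (\<lambda>t. below_chord (w t) a b) F"
proof -
  have "eventually (\<lambda>t. \<forall>i\<in>{a<..<b}.
      real (b - a) * w t i < real (b - i) * w t a + real (i - a) * w t b) F"
    by (rule eventually_ball_finite) (use assms in auto)
  then show ?thesis by eventually_elim (auto simp: below_chord_def)
qed

text \<open>
  The hypotheses of \<open>four_vertex_tropicalization\<close> for the vertices \<open>0\<close>, \<open>p\<close>, \<open>p + 21\<close>, \<open>d\<close>. Each of
  them either does not depend on \<open>t\<close> or has the form \<open>a * ln t < b\<close> with \<open>a > 0\<close>.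
\<close>

lemma eventually_edge_poly_chords:
  fixes lam :: "nat \<Rightarrow> real" and d p :: nat
  defines "l \<equiv> \<lambda>k. ln (lam k)"
  defines "w \<equiv> \<lambda>t k. ln (edge_coeff p t k) + l k"
  assumes p: "0 < p" "p + 21 < d"
    and conv: "\<And>j. p < j \<Longrightarrow> j < p + 21 \<Longrightarrow> 2 * l j - l (j - 1) - l (j + 1) \<le> 2 * (1 / 1000)"
  shows "eventually (\<lambda>t. below_chord (w t) 0 p \<and> below_chord (w t) p (p + 21)
      \<and> below_chord (w t) (p + 21) d
      \<and> (w t 0 - w t p) / real (p - 0) < (w t p - w t (p + 21)) / real (p + 21 - p)
      \<and> (w t p - w t (p + 21)) / real (p + 21 - p)
        < (w t (p + 21) - w t d) / real (d - (p + 21))) (at_right 0)"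
proof (intro eventually_conj)
  let ?q = "p + 21"
  have w_vertex: "w t p = l p" "w t ?q = l ?q" for t
    by (simp_all add: w_def edge_coeff_def)
  have w_outside: "w t i = ln t + l i" if "i < p \<or> ?q < i" for t i
    using that by (auto simp: w_def edge_coeff_def)
  show "eventually (\<lambda>t. below_chord (w t) 0 p) (at_right 0)"
  proof (rule eventually_below_chord)
    fix i assume i: "0 < i" "i < p"
    have "eventually (\<lambda>t. real i * ln t < real (p - i) * l 0 + real i * l p - real p * l i) (at_right 0)"
      by (rule eventually_ln_less) (use i in simp)
    then show "eventually (\<lambda>t. real (p - 0) * w t i
        < real (p - i) * w t 0 + real (i - 0) * w t p) (at_right 0)"
      by eventually_elim (use i in \<open>simp add: w_vertex w_outside of_nat_diff algebra_simps\<close>)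
  qed
  show "eventually (\<lambda>t. below_chord (w t) ?q d) (at_right 0)"
  proof (rule eventually_below_chord)
    fix i assume i: "?q < i" "i < d"
    have "eventually (\<lambda>t. real (d - i) * ln t
        < real (d - i) * l ?q + real (i - ?q) * l d - real (d - ?q) * l i) (at_right 0)"
      by (rule eventually_ln_less) (use i in simp)
    then show "eventually (\<lambda>t. real (d - ?q) * w t i
        < real (d - i) * w t ?q + real (i - ?q) * w t d) (at_right 0)"
      by eventually_elim (use i in \<open>simp add: w_vertex w_outside of_nat_diff algebra_simps\<close>)
  qed
  show "eventually (\<lambda>t. below_chord (w t) p ?q) (at_right 0)"
  proof (rule eventually_below_chord)
    fix i assume i: "p < i" "i < ?q"
    show "eventually (\<lambda>t. real (?q - p) * w t i
        < real (?q - i) * w t p + real (i - p) * w t ?q) (at_right 0)"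
    proof (cases "i \<in> {p + 1, p + 3, p + 18, p + 20}")
      case True
      define m where "m = i - p"
      have m: "i = p + m" "m \<in> {1, 3, 18, 20}" using True by (auto simp: m_def)
      \<comment> \<open>The product \<open>m * (21 - m)\<close> is at most \<open>54\<close>, and \<open>54 / 1000 < 1 / 10 \<le> - ln (9 / 10)\<close>.\<close>
      have "real 21 * l (p + m) \<le> real (21 - m) * l (p + 0) + real m * l (p + 21)
          + 1 / 1000 * real (21 * (m * (21 - m)))"
      proof (rule near_convex_chord)
        fix j :: nat assume "0 < j" "j < 21"
        then show "2 * l (p + j) - l (p + (j - 1)) - l (p + (j + 1)) \<le> 2 * (1 / 1000)"
          using conv[of "p + j"] by simp
      qed (use m in auto)
      moreover have "ln (9 / 10 :: real) \<le> 9 / 10 - 1" by (rule ln_le_minus_one) simp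
      moreover have "w t i = ln (9 / 10) + l i" for t
        using True by (auto simp: w_def edge_coeff_def)
      ultimately have "real (?q - p) * w t i < real (?q - i) * w t p + real (i - p) * w t ?q" for t
        using m by (auto simp: w_vertex algebra_simps)
      then show ?thesis by simp
    next
      case False
      then have w_i: "w t i = ln t + l i" for t
        using i by (auto simp: w_def edge_coeff_def)
      have "eventually (\<lambda>t. 21 * ln t
          < real (?q - i) * l p + real (i - p) * l ?q - 21 * l i) (at_right 0)"
        by (rule eventually_ln_less) simp
      then show ?thesis by eventually_elim (simp add: w_i w_vertex algebra_simps)
    qed
  qed
  have "eventually (\<lambda>t. 1 * ln t < real p * ((l p - l ?q) / 21) - l 0 + l p) (at_right 0)"
    by (rule eventually_ln_less) simp
  then show "eventually (\<lambda>t. (w t 0 - w t p) / real (p - 0)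
      < (w t p - w t ?q) / real (?q - p)) (at_right 0)"
    by eventually_elim (use p in \<open>simp add: w_vertex w_outside field_simps\<close>)
  have "eventually (\<lambda>t. 1 * ln t < l ?q - l d - real (d - ?q) * ((l p - l ?q) / 21)) (at_right 0)"
    by (rule eventually_ln_less) simp
  then show "eventually (\<lambda>t. (w t p - w t ?q) / real (?q - p)
      < (w t ?q - w t d) / real (d - ?q)) (at_right 0)"
    by eventually_elim (use p in \<open>simp add: w_vertex w_outside of_nat_diff field_simps\<close>)
qed

lemma exists_poly_four_negative_roots:
  fixes lam :: "nat \<Rightarrow> real" and d p :: nat
  assumes lam: "\<And>k. k \<le> d \<Longrightarrow> lam k > 0" and p: "odd p" "p + 21 < d"
    and conv: "\<And>j. p < j \<Longrightarrow> j < p + 21 \<Longrightarrow>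
      2 * ln (lam j) - ln (lam (j - 1)) - ln (lam (j + 1)) \<le> 2 * (1 / 1000)"
  obtains P where "degree P = d" "pos_coeffs P"
    "card (tropical_roots lam P) = 3"
    "(\<Sum>\<xi>\<in>tropical_roots lam P. tropical_mult lam P \<xi>) = 3"
    "card {x. x < 0 \<and> poly P x = 0} \<ge> 4" "card (tropical_indices lam P) \<le> 4"
proof -
  have "0 < p" using p(1) by (rule odd_pos)
  define w where "w = (\<lambda>t k. ln (edge_coeff p t k) + ln (lam k))"
  have "eventually (\<lambda>t. t > (0::real)) (at_right 0)" by (simp add: eventually_at_right_less)
  from eventually_happens'[OF trivial_limit_at_right_real eventually_conj[OF this eventually_conj[OF
        eventually_edge_poly_negative_roots[OF less_imp_le[OF p(2)] p(1)]
        eventually_edge_poly_chords[where lam = lam, OF \<open>0 < p\<close> p(2) conv]]]]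
  obtain t where t: "t > 0"
    and roots: "card {x. x < 0 \<and> poly (edge_poly d p t) x = 0} \<ge> 4"
    and chords: "below_chord (w t) 0 p" "below_chord (w t) p (p + 21)" "below_chord (w t) (p + 21) d"
    and slopes: "(w t 0 - w t p) / real (p - 0) < (w t p - w t (p + 21)) / real (p + 21 - p)"
      "(w t p - w t (p + 21)) / real (p + 21 - p) < (w t (p + 21) - w t d) / real (d - (p + 21))"
    unfolding w_def by blast
  let ?P = "edge_poly d p t"
  have deg: "degree ?P = d" and pos: "pos_coeffs ?P"
    using t by (simp_all add: degree_edge_poly pos_coeffs_edge_poly)
  have "trop_term lam ?P k 0 = w t k" if "k \<le> d" for k
    using that edge_coeff_pos[OF t, of p k] by (simp add: trop_term_def w_def coeff_edge_poly)
  then have chords': "below_chord (\<lambda>k. trop_term lam ?P k 0) 0 p"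
      "below_chord (\<lambda>k. trop_term lam ?P k 0) p (p + 21)"
      "below_chord (\<lambda>k. trop_term lam ?P k 0) (p + 21) (degree ?P)"
    and slopes': "(trop_term lam ?P 0 0 - trop_term lam ?P p 0) / real (p - 0)
        < (trop_term lam ?P p 0 - trop_term lam ?P (p + 21) 0) / real (p + 21 - p)"
      "(trop_term lam ?P p 0 - trop_term lam ?P (p + 21) 0) / real (p + 21 - p)
        < (trop_term lam ?P (p + 21) 0 - trop_term lam ?P (degree ?P) 0) / real (degree ?P - (p + 21))"
    using chords slopes p(2) by (simp_all add: below_chord_def deg)
  have q: "p < p + 21" "p + 21 < degree ?P" using p(2) deg by simp_all
  note four = four_vertex_tropicalization[OF pos \<open>0 < p\<close> q chords' slopes']
  have "tropical_indices lam ?P \<subseteq> {0, p, p + 21, d}"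
  proof
    fix k assume k: "k \<in> tropical_indices lam ?P"
    then have "k \<le> degree ?P" by (simp add: tropical_indices_def)
    obtain \<xi> where "\<And>i. i \<le> degree ?P \<Longrightarrow> trop_term lam ?P i \<xi> \<le> trop_term lam ?P k \<xi>"
      using tropical_indices_maximize[OF _ pos k] lam deg by auto
    then have "k \<in> {0, p, p + 21, degree ?P}" by (rule four(3)[OF \<open>k \<le> degree ?P\<close>])
    then show "k \<in> {0, p, p + 21, d}" unfolding deg .
  qed
  then have "card (tropical_indices lam ?P) \<le> card {0, p, p + 21, d}"
    by (rule card_mono[rotated]) simp
  also have "\<dots> \<le> 4" by (simp add: card_insert_if)
  finally show ?thesis using that deg pos four(1,2) roots by blast
qed

theorem theorem11:
  shows "\<exists>c::real. c > 0 \<and>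
    (\<forall>(d::nat) (lam :: nat \<Rightarrow> real).
      d > 0 \<longrightarrow>
      (\<forall>k\<le>d. lam k > 0) \<longrightarrow>
      (\<exists>k::nat. 1 \<le> k \<and> k + 100 < d \<and>
         (\<forall>j\<in>{k..k + 100}. ln ((lam j)\<^sup>2 / (lam (j - 1) * lam (j + 1))) < 2 * c)) \<longrightarrow>
      (\<exists>P :: real poly. degree P = d \<and> pos_coeffs P \<and>
         card (tropical_roots lam P) = 3 \<and>
         (\<Sum>\<xi>\<in>tropical_roots lam P. tropical_mult lam P \<xi>) = 3 \<and>
         card {x. x < 0 \<and> poly P x = 0} \<ge> 4) \<and>
      \<not> root_preserver d lam \<and>
      \<not> positive_root_preserver d lam)"
proof (intro exI[of _ "1 / 1000"] conjI allI impI)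
  show "(1 / 1000 :: real) > 0" by simp
next
  fix d :: nat and lam :: "nat \<Rightarrow> real"
  assume "d > 0" and "\<forall>k\<le>d. lam k > 0"
    and "\<exists>k::nat. 1 \<le> k \<and> k + 100 < d \<and>
      (\<forall>j\<in>{k..k + 100}. ln ((lam j)\<^sup>2 / (lam (j - 1) * lam (j + 1))) < 2 * (1 / 1000))"
  then obtain k where lam: "\<And>j. j \<le> d \<Longrightarrow> lam j > 0" and k: "1 \<le> k" "k + 100 < d"
    and conv: "\<And>j. k \<le> j \<Longrightarrow> j \<le> k + 100 \<Longrightarrow>
      ln ((lam j)\<^sup>2 / (lam (j - 1) * lam (j + 1))) < 2 * (1 / 1000)"
    by auto
  define p where "p = (if odd k then k else k + 1)"
  \<comment> \<open>The indices strictly between \<open>p\<close> and \<open>p + 21\<close> lie between \<open>k\<close> and \<open>k + 100\<close>.\<close>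
  have p: "odd p" "k \<le> p" "p \<le> k + 1" by (auto simp: p_def)
  have second_diff: "2 * ln (lam j) - ln (lam (j - 1)) - ln (lam (j + 1)) \<le> 2 * (1 / 1000)"
    if j: "p < j" "j < p + 21" for j
  proof -
    have "lam j > 0" "lam (j - 1) > 0" "lam (j + 1) > 0"
      using lam j p k by simp_all
    then have "ln ((lam j)\<^sup>2 / (lam (j - 1) * lam (j + 1)))
        = 2 * ln (lam j) - ln (lam (j - 1)) - ln (lam (j + 1))"
      by (simp add: ln_div ln_mult ln_realpow)
    then show ?thesis using conv[of j] j p by simp
  qed
  have "p + 21 < d" using p k by simp
  from exists_poly_four_negative_roots[OF lam p(1) this second_diff]
  obtain P where P: "degree P = d" "pos_coeffs P"
    "card (tropical_roots lam P) = 3"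
    "(\<Sum>\<xi>\<in>tropical_roots lam P. tropical_mult lam P \<xi>) = 3"
    "card {x. x < 0 \<and> poly P x = 0} \<ge> 4" "card (tropical_indices lam P) \<le> 4" .
  then show "\<exists>P :: real poly. degree P = d \<and> pos_coeffs P \<and>
      card (tropical_roots lam P) = 3 \<and>
      (\<Sum>\<xi>\<in>tropical_roots lam P. tropical_mult lam P \<xi>) = 3 \<and>
      card {x. x < 0 \<and> poly P x = 0} \<ge> 4"
    by blast
  have "P \<noteq> 0" using P(1) \<open>d > 0\<close> by auto
  have "finite {x. x \<noteq> 0 \<and> poly P x = 0}"
    by (rule finite_subset[OF _ poly_roots_finite[OF \<open>P \<noteq> 0\<close>]]) auto
  then have "card {x. x < 0 \<and> poly P x = 0} \<le> card {x. x \<noteq> 0 \<and> poly P x = 0}"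
    by (rule card_mono) auto
  then have "essential_roots lam P < card {x. x \<noteq> 0 \<and> poly P x = 0}"
    using essential_roots_pos_coeffs_le[OF P(2), of lam] P(5,6) by linarith
  then show "\<not> root_preserver d lam" "\<not> positive_root_preserver d lam"
    using P(1,2) \<open>P \<noteq> 0\<close> by (auto simp: root_preserver_def positive_root_preserver_def not_le)
qed

end
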